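(* Let $A\in\mathbf{R}^{N\times n}$ with $N>n$ satisfy the rank* condition. Then there exists a unique diagonal matrix $D\in\mathbf{R}^{N\times N}$ with $D_{i,i}>0$ for all $i$, normalized by $\|D^{-1/2}A\|_F^2=N$, such that $$D^{-1/2}A=QB$$ for some nonsingular matrix $B\in\mathbf{R}^{n\times n}$ and some matrix $Q\in\mathbf{R}^{N\times n}$ with $Q^\top Q=I_{n\times n}$ and $(QQ^\top)_{i,i}=n/N$ for all $i=1,\dots,N$.
   Context: A matrix $A\in\mathbf{R}^{N\times n}$ satisfies the rank* condition if $N>n$ and every $n\times n$ square submatrix of $A$ has full rank, i.e. any $n$ rows of $A$ are linearly independent. $\|\cdot\|_F$ is the Frobenius norm. *)

theory Defs
  imports "HOL-Analysis.Analysis"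
begin

text \<open>Matrices with \<open>N\<close> rows and \<open>n\<close> columns are elements of \<open>real ^ 'n ^ 'm\<close>, where
  \<open>N = CARD('m)\<close> and \<open>n = CARD('n)\<close>.  A choice of \<open>n\<close> distinct rows is an injection
  \<open>f :: 'n \<Rightarrow> 'm\<close>; different orderings of the same rows do not affect the rank.\<close>

definition rank_star :: "real ^ 'n ^ 'm \<Rightarrow> bool" where
  "rank_star A \<longleftrightarrow>
     CARD('n) < CARD('m) \<and>
     (\<forall>f :: 'n \<Rightarrow> 'm. inj f \<longrightarrow> rank (\<chi> i j. A $ f i $ j) = CARD('n))"

definition is_diagonal :: "real ^ 'm ^ 'm \<Rightarrow> bool" where
  "is_diagonal D \<longleftrightarrow> (\<forall>i j. i \<noteq> j \<longrightarrow> D $ i $ j = 0)"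

text \<open>The power \<open>D\<^sup>-\<^sup>1\<^sup>/\<^sup>2\<close>; meaningful only for diagonal \<open>D\<close> with positive diagonal entries.\<close>

definition diag_inv_sqrt :: "real ^ 'm ^ 'm \<Rightarrow> real ^ 'm ^ 'm" where
  "diag_inv_sqrt D = (\<chi> i j. if i = j then 1 / sqrt (D $ i $ i) else 0)"

definition frobenius_norm :: "real ^ 'n ^ 'm \<Rightarrow> real" where
  "frobenius_norm A = sqrt (\<Sum>i\<in>UNIV. \<Sum>j\<in>UNIV. (A $ i $ j)\<^sup>2)"

lemma frobenius_norm_eq_norm: "frobenius_norm A = norm A"
  unfolding frobenius_norm_def norm_vec_def L2_set_def
  by (simp add: sum_nonneg)

end

theory Submission
  imports Defs
begin

text \<open>
  Write \<open>a\<^sub>i\<close> for the rows of \<open>A\<close>.  Putting \<open>s\<^sub>i = D\<^sub>i\<^sub>i\<^bsup>-1/2\<^esup>\<close>, the claim is that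
  the vectors \<open>a\<^sub>i\<close> can be rescaled by positive factors \<open>s\<^sub>i\<close>, in a way that is unique up to a common
  factor, such that a linear change of coordinates turns them into a tight frame of vectors of
  equal length.

  Existence is variational.  Among all pairs of a matrix \<open>C\<close> with \<open>det C = 1\<close> and a positive
  vector \<open>s\<close> with \<open>\<Prod> s\<^sub>i = 1\<close>, minimise the Frobenius norm of the matrix with columns
  \<open>s\<^sub>i C a\<^sub>i\<close>.  A minimum exists because the sublevel sets are bounded
  (\<open>unimodular_sublevel_bounded\<close>): the \<open>n\<close> by \<open>n\<close> minors of that matrix stay bounded, and each
  is a fixed nonzero number times a product of \<open>n\<close> of the \<open>s\<^sub>i\<close>; as \<open>n < N\<close> and the full product
  is 1, no \<open>s\<^sub>i\<close> can tend to infinity or to 0, and then \<open>C\<close> is bounded as well.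
  At a minimum (\<open>minimal_scaled_frame_balanced\<close>), adding a multiple of one row of \<open>C\<close> to another
  cannot decrease the norm, so the rows of the matrix are orthogonal; multiplying one row by \<open>t\<close>
  and another by \<open>1/t\<close> cannot decrease it either, so the rows have equal length; and the same
  with two entries of \<open>s\<close> shows that the columns have equal length.  Up to normalisation the
  transpose of the matrix is \<open>Q\<close>.

  For uniqueness, two solutions give frames related by \<open>F\<^sup>T q'\<^sub>i = \<rho>\<^sub>i q\<^sub>i\<close> with one linear map \<open>F\<close>.
  Parseval's identity and the Cauchy-Schwarz inequality force every \<open>q\<^sub>i\<close> with maximal \<open>\<rho>\<^sub>i\<close> to be
  orthogonal to every \<open>q\<^sub>j\<close> with smaller \<open>\<rho>\<^sub>j\<close> (\<open>tight_frame_scaling_constant\<close>).  But more than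
  \<open>n\<close> vectors in general position cannot be split into two nonempty mutually orthogonal parts
  (\<open>not_orthogonally_split\<close>), so \<open>\<rho>\<close> is constant, and the normalisation makes it 1.
\<close>

section \<open>Vectors in general position\<close>

text \<open>Linear independence of any \<open>n\<close> rows, phrased dually: only the zero vector is orthogonal to
  \<open>n\<close> distinct rows.  In this form the property passes easily through linear changes of coordinates and
  positive rescalings.\<close>

definition general_position :: "real ^ 'n ^ 'm \<Rightarrow> bool" where
  "general_position A \<longleftrightarrow>
     (\<forall>f :: 'n \<Rightarrow> 'm. inj f \<longrightarrow> (\<forall>z. (\<forall>k. A $ f k \<bullet> z = 0) \<longrightarrow> z = 0))"

lemma rank_star_imp_general_position:
  fixes A :: "real ^ 'n ^ 'm"
  assumes "rank_star A"
  shows "general_position A"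
  unfolding general_position_def
proof (intro allI impI)
  fix f :: "'n \<Rightarrow> 'm" and z :: "real ^ 'n"
  assume "inj f" and z: "\<forall>k. A $ f k \<bullet> z = 0"
  have "inj ((*v) (\<chi> i. A $ f i))"
    using assms \<open>inj f\<close> by (simp add: rank_star_def flip: full_rank_injective)
  moreover have "(\<chi> i. A $ f i) *v z = (\<chi> i. A $ f i) *v 0"
    using z by (simp add: vec_eq_iff matrix_vector_mul_component)
  ultimately show "z = 0"
    by (rule injD)
qed

lemma general_position_invertible:
  fixes A :: "real ^ 'n ^ 'm" and f :: "'n \<Rightarrow> 'm"
  assumes "general_position A" "inj f"
  shows "invertible (\<chi> k. A $ f k)"
proof -
  have "x = 0" if "(\<chi> k. A $ f k) *v x = 0" for x
    using assms that by (simp add: general_position_def vec_eq_iff[of "_ *v _"] matrix_vector_mul_component)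
  then show ?thesis
    by (simp add: invertible_left_inverse matrix_left_invertible_ker)
qed

section \<open>Rigidity of tight frames\<close>

lemma parseval_orthonormal_columns:
  fixes Q :: "real ^ 'n ^ 'm"
  assumes "transpose Q ** Q = mat 1"
  shows "(\<Sum>k\<in>UNIV. (Q $ k \<bullet> u) * (Q $ k \<bullet> v)) = u \<bullet> v"
proof -
  have "(\<Sum>k\<in>UNIV. (Q $ k \<bullet> u) * (Q $ k \<bullet> v)) = (Q *v u) \<bullet> (Q *v v)"
    by (simp add: inner_vec_def[of "_ *v _"] matrix_vector_mul_component)
  also have "\<dots> = u \<bullet> ((transpose Q ** Q) *v v)"
    by (metis dot_lmul_matrix inner_commute matrix_vector_mul_assoc transpose_matrix_vector)
  finally show ?thesis using assms by simp
qed

text \<open>Choose a vector \<open>z\<close> orthogonal to \<open>n - 1\<close> rows other than \<open>i\<close> and \<open>j\<close>, with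
  \<open>q\<^sub>j \<bullet> z = 1\<close>.  The part \<open>z\<^sub>T\<close> of the frame expansion of \<open>z\<close> that runs over \<open>T\<close> has the same inner
  products as \<open>z\<close> with the rows in \<open>T\<close> and is orthogonal to all others, \<open>q\<^sub>j\<close> included.  So it is
  orthogonal to \<open>n\<close> rows and vanishes, whence \<open>q\<^sub>i \<bullet> z = 0\<close>.  Now \<open>z\<close> itself is
  orthogonal to \<open>n\<close> rows, contradicting \<open>q\<^sub>j \<bullet> z = 1\<close>.\<close>

lemma not_orthogonally_split:
  fixes Q :: "real ^ 'n ^ 'm" and T :: "'m set"
  assumes less: "CARD('n) < CARD('m)" and gp: "general_position Q"
    and orth: "transpose Q ** Q = mat 1"
    and split: "\<And>i j. i \<in> T \<Longrightarrow> j \<notin> T \<Longrightarrow> Q $ i \<bullet> Q $ j = 0"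
    and i: "i \<in> T" and j: "j \<notin> T"
  shows False
proof -
  fix k0 :: 'n
  have "card (UNIV - {k0}) \<le> card (UNIV - {i, j})"
    using less i j by (subst (1 2) card_Diff_subset) (auto simp: card_insert_if)
  then obtain g where g: "g ` (UNIV - {k0}) \<subseteq> UNIV - {i, j}" "inj_on g (UNIV - {k0})"
    using card_le_inj[of "UNIV - {k0}" "UNIV - {i, j}"] by auto
  \<comment> \<open>The map \<open>g\<close> selects \<open>n - 1\<close> common rows; the remaining slot \<open>k0\<close> is filled once with
    \<open>j\<close> and once with \<open>i\<close>.\<close>
  have inj: "inj (g(k0 := x))" if "x \<in> {i, j}" for x
    using g that unfolding inj_on_def by (auto split: if_splits)
  obtain G where G: "(\<chi> k. Q $ (g(k0 := j)) k) ** G = mat 1"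
    using general_position_invertible[OF gp inj] invertible_right_inverse by (metis insertCI)
  define z where "z = G *v axis k0 1"
  have "(\<chi> k. Q $ (g(k0 := j)) k) *v z = axis k0 1"
    by (simp add: z_def matrix_vector_mul_assoc G del: fun_upd_apply)
  then have z: "Q $ (g(k0 := j)) k \<bullet> z = axis k0 1 $ k" for k
    by (metis matrix_vector_mul_component vec_lambda_beta)
  have zj: "Q $ j \<bullet> z = 1" using z[of k0] by simp
  have zg: "Q $ g k \<bullet> z = 0" if "k \<noteq> k0" for k
    using z[of k] that by (simp add: axis_def)
  define zT where "zT = (\<Sum>k\<in>T. (Q $ k \<bullet> z) *\<^sub>R Q $ k)"
  have zT_in: "Q $ x \<bullet> zT = Q $ x \<bullet> z" if "x \<in> T" for x
  proof -
    have "Q $ x \<bullet> zT = (\<Sum>k\<in>T. (Q $ k \<bullet> Q $ x) * (Q $ k \<bullet> z))"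
      by (simp add: zT_def inner_sum_right inner_commute mult.commute)
    also have "\<dots> = (\<Sum>k\<in>UNIV. (Q $ k \<bullet> Q $ x) * (Q $ k \<bullet> z))"
      using split[of x] that by (intro sum.mono_neutral_left) (auto simp: inner_commute)
    finally show ?thesis by (simp add: parseval_orthonormal_columns[OF orth])
  qed
  have zT_out: "Q $ x \<bullet> zT = 0" if "x \<notin> T" for x
    using split that by (simp add: zT_def inner_sum_right inner_commute)
  have "zT = 0"
  proof -
    have "Q $ (g(k0 := j)) k \<bullet> zT = 0" for k
      using zT_in zT_out zg j by (cases "g k \<in> T"; cases "k = k0") auto
    then show ?thesis using gp inj[of j] unfolding general_position_def by blast
  qed
  then have "Q $ i \<bullet> z = 0" using zT_in[OF i] by simp
  then have "Q $ (g(k0 := i)) k \<bullet> z = 0" for k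
    using zg by simp
  then have "z = 0" using gp inj[of i] unfolding general_position_def by blast
  with zj show False by simp
qed

text \<open>The relation between the frames reads \<open>F\<^sup>T q'\<^sub>i = \<rho>\<^sub>i q\<^sub>i\<close>.  If \<open>\<rho>\<^sub>k\<close> is the maximum
  \<open>r\<close>, then \<open>r |q\<^sub>k|\<^sup>2 = q'\<^sub>k \<bullet> F q\<^sub>k \<le> |q'\<^sub>k| |F q\<^sub>k|\<close>, while Parseval's identity for the two frames gives
  \<open>|F q\<^sub>k|\<^sup>2 = \<Sum> \<rho>\<^sub>m\<^sup>2 (q\<^sub>m \<bullet> q\<^sub>k)\<^sup>2 \<le> r\<^sup>2 |q\<^sub>k|\<^sup>2\<close>.  As all lengths agree, both are equalities,
  and every \<open>q\<^sub>m\<close> with \<open>\<rho>\<^sub>m < r\<close> is orthogonal to \<open>q\<^sub>k\<close>.\<close>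

lemma tight_frame_scaling_constant:
  fixes Q Q' :: "real ^ 'n ^ 'm" and F :: "real ^ 'n ^ 'n" and \<rho> :: "'m \<Rightarrow> real"
  assumes less: "CARD('n) < CARD('m)" and gp: "general_position Q"
    and orth: "transpose Q ** Q = mat 1" and orth': "transpose Q' ** Q' = mat 1"
    and len: "\<And>i. Q $ i \<bullet> Q $ i = c" and len': "\<And>i. Q' $ i \<bullet> Q' $ i = c"
    and pos: "\<And>i. \<rho> i > 0"
    and rel: "\<And>i v. Q' $ i \<bullet> (F *v v) = \<rho> i * (Q $ i \<bullet> v)"
  shows "\<rho> i = \<rho> j"
proof -
  define r where "r = Max (range \<rho>)"
  have r: "\<rho> k \<le> r" for k by (simp add: r_def)
  have "r \<in> range \<rho>" unfolding r_def by (rule Max_in) auto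
  then obtain i0 where i0: "\<rho> i0 = r" by auto
  have perp: "Q $ k \<bullet> Q $ l = 0" if k: "\<rho> k = r" and l: "\<rho> l \<noteq> r" for k l
  proof -
    let ?q = "Q $ k" and ?y = "F *v (Q $ k)"
    have "(r * (?q \<bullet> ?q))\<^sup>2 = (Q' $ k \<bullet> ?y)\<^sup>2" by (simp add: rel k)
    also have "\<dots> \<le> (Q' $ k \<bullet> Q' $ k) * (?y \<bullet> ?y)" by (rule Cauchy_Schwarz_ineq)
    finally have "c * (r\<^sup>2 * c) \<le> c * (?y \<bullet> ?y)"
      by (simp add: len len' power2_eq_square algebra_simps)
    moreover have "c \<ge> 0" using len[of k] inner_ge_zero[of ?q] by simp
    ultimately have A: "r\<^sup>2 * c \<le> ?y \<bullet> ?y"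
      by (cases "c = 0") auto
    have B: "?y \<bullet> ?y = (\<Sum>m\<in>UNIV. (\<rho> m)\<^sup>2 * (Q $ m \<bullet> ?q)\<^sup>2)"
      using parseval_orthonormal_columns[OF orth', of ?y ?y]
      by (simp add: rel power2_eq_square mult_ac)
    have C: "c = (\<Sum>m\<in>UNIV. (Q $ m \<bullet> ?q)\<^sup>2)"
      using parseval_orthonormal_columns[OF orth, of ?q ?q] by (simp add: len power2_eq_square)
    \<comment> \<open>The two bounds on \<open>?y \<bullet> ?y\<close> meet only if each of these nonnegative terms vanishes.\<close>
    have "(\<Sum>m\<in>UNIV. (r\<^sup>2 - (\<rho> m)\<^sup>2) * (Q $ m \<bullet> ?q)\<^sup>2) \<le> 0"
      using A unfolding B by (subst (asm) C) (simp add: sum_distrib_left left_diff_distrib sum_subtractf)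
    moreover have nonneg: "(r\<^sup>2 - (\<rho> m)\<^sup>2) * (Q $ m \<bullet> ?q)\<^sup>2 \<ge> 0" for m
      using r[of m] pos[of m] by (intro mult_nonneg_nonneg) (auto intro: power_mono)
    ultimately have "(\<Sum>m\<in>UNIV. (r\<^sup>2 - (\<rho> m)\<^sup>2) * (Q $ m \<bullet> ?q)\<^sup>2) = 0"
      by (meson sum_nonneg order_antisym)
    then have "(r\<^sup>2 - (\<rho> l)\<^sup>2) * (Q $ l \<bullet> ?q)\<^sup>2 = 0"
      using nonneg by (simp add: sum_nonneg_eq_0_iff)
    moreover have "(\<rho> l)\<^sup>2 < r\<^sup>2" using r[of l] l pos[of l] by (intro power_strict_mono) auto
    ultimately show ?thesis by (simp add: inner_commute)
  qed
  have "\<rho> k = r" for k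
  proof (rule ccontr)
    assume "\<rho> k \<noteq> r"
    then show False
      using not_orthogonally_split[OF less gp orth, of "{k. \<rho> k = r}" i0 k] perp i0 by simp
  qed
  then show ?thesis by simp
qed

section \<open>Boundedness from products over subsets\<close>

lemma ex_top_set:
  fixes f :: "'a::finite \<Rightarrow> 'b::linorder"
  assumes "k \<le> CARD('a)"
  shows "\<exists>S. card S = k \<and> (\<forall>x\<in>S. \<forall>y\<in>-S. f y \<le> f x)"
  using assms
proof (induction k)
  case 0
  then show ?case by (intro exI[of _ "{}"]) simp
next
  case (Suc k)
  then obtain S where S: "card S = k" "\<forall>x\<in>S. \<forall>y\<in>-S. f y \<le> f x" by auto
  have "- S \<noteq> {}" using S(1) Suc.prems by (metis Compl_empty_eq double_complement Suc_n_not_le_n)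
  then have "Max (f ` (- S)) \<in> f ` (- S)" by (intro Max_in) auto
  then obtain m where m: "m \<in> - S" "f m = Max (f ` (- S))" by auto
  have "f y \<le> f m" if "y \<in> - S" for y using that by (simp add: m)
  then show ?case using S m(1) by (intro exI[of _ "insert m S"]) auto
qed

text \<open>Let \<open>S\<close> hold the \<open>n\<close> largest values and let \<open>c\<close> be the largest value outside
  \<open>S\<close>.  Since the full product is 1, the product over the complement is at least \<open>1/K\<close>, which
  makes \<open>c \<ge> 1/K\<close>.  All values in \<open>S\<close> are at least \<open>c\<close>, so a single large one would make
  the product over \<open>S\<close> exceed \<open>K\<close>.\<close>

lemma bounded_if_subset_products_bounded:
  fixes s :: "'m::finite \<Rightarrow> real"
  assumes n: "0 < n" "n < CARD('m)" and pos: "\<And>i. s i > 0" and prod: "(\<Prod>i\<in>UNIV. s i) = 1"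
    and K: "K \<ge> 1" and le: "\<And>S. card S = n \<Longrightarrow> (\<Prod>i\<in>S. s i) \<le> K"
  shows "s i \<le> K ^ n"
proof -
  obtain S where S: "card S = n" "\<forall>x\<in>S. \<forall>y\<in>-S. s y \<le> s x"
    using ex_top_set[of n s] n by auto
  have cS: "card (- S) = CARD('m) - n" using card_Diff_subset[of S UNIV] S(1) by (simp add: Compl_eq_Diff_UNIV)
  define c where "c = Max (s ` (- S))"
  have "- S \<noteq> {}" using cS n by auto
  then have "c \<in> s ` (- S)" unfolding c_def by (intro Max_in) auto
  then have c: "c > 0" "\<And>x. x \<in> S \<Longrightarrow> c \<le> s x" using pos S(2) by auto
  have c': "s y \<le> c" if "y \<in> - S" for y using that by (simp add: c_def)
  have "1 = (\<Prod>i\<in>S. s i) * (\<Prod>i\<in>-S. s i)"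
    using prod.union_disjoint[of S "-S" s] by (simp add: prod)
  also have "\<dots> \<le> K * c ^ (CARD('m) - n)"
  proof (rule mult_mono)
    show "(\<Prod>i\<in>-S. s i) \<le> c ^ (CARD('m) - n)"
      using prod_mono[of "-S" s "\<lambda>_. c"] c' pos cS by (simp add: less_imp_le)
  qed (use le[OF S(1)] K pos in \<open>auto intro: prod_nonneg less_imp_le\<close>)
  finally have 1: "1 \<le> K * c ^ (CARD('m) - n)" .
  have Kc: "1 \<le> K * c"
  proof (cases "c \<ge> 1")
    case True
    then show ?thesis using mult_mono[of 1 K 1 c] K by simp
  next
    case False
    then have "c ^ (CARD('m) - n) \<le> c"
      using power_decreasing[of 1 "CARD('m) - n" c] n c by simp
    then show ?thesis using 1 K by (meson mult_left_mono order_trans zero_le_one)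
  qed
  have main: "s x \<le> K ^ n" if x: "x \<in> S" for x
  proof -
    have "s x * c ^ (n - 1) = s x * (\<Prod>i\<in>S - {x}. c)" using x S(1) by simp
    also have "\<dots> \<le> s x * (\<Prod>i\<in>S - {x}. s i)"
      using c pos[of x] by (intro mult_left_mono prod_mono) auto
    also have "\<dots> = (\<Prod>i\<in>S. s i)" using x by (simp add: prod.remove)
    also have "\<dots> \<le> K" using le S(1) by simp
    finally have A: "s x * c ^ (n - 1) \<le> K" .
    have "s x * 1 \<le> s x * (K * c) ^ (n - 1)"
      using Kc pos[of x] by (intro mult_left_mono one_le_power) auto
    also have "\<dots> = K ^ (n - 1) * (s x * c ^ (n - 1))" by (simp add: power_mult_distrib)
    also have "\<dots> \<le> K ^ (n - 1) * K" using A K by (intro mult_left_mono) auto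
    also have "\<dots> = K ^ n" using n by (simp add: power_eq_if mult.commute)
    finally show ?thesis by simp
  qed
  show ?thesis
  proof (cases "i \<in> S")
    case False
    obtain x where "x \<in> S" using S(1) n by fastforce
    then show ?thesis using main[of x] c' [of i] c(2)[of x] False by simp
  qed (rule main)
qed

section \<open>A minimisation problem for rescaled frames\<close>

definition scaled_frame :: "real ^ 'n ^ 'm \<Rightarrow> real ^ 'n ^ 'n \<Rightarrow> real ^ 'm \<Rightarrow> real ^ 'm ^ 'n" where
  "scaled_frame A C s = (\<chi> p i. s $ i * (C $ p \<bullet> A $ i))"

text \<open>The constraint set of the minimisation; it removes the freedom to shrink the norm by scaling
  \<open>C\<close> or \<open>s\<close>.\<close>

definition unimodular :: "real ^ 'n ^ 'n \<Rightarrow> real ^ 'm \<Rightarrow> bool" where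
  "unimodular C s \<longleftrightarrow> det C = 1 \<and> (\<forall>i. s $ i > 0) \<and> (\<Prod>i\<in>UNIV. s $ i) = 1"

lemma det_bounded_by_entries:
  "\<exists>M>0. \<forall>X :: real ^ 'n ^ 'n. (\<forall>i j. \<bar>X $ i $ j\<bar> \<le> K) \<longrightarrow> \<bar>det X\<bar> \<le> M"
proof -
  let ?P = "{p. p permutes (UNIV :: 'n set)}"
  have "\<bar>det X\<bar> \<le> (\<Sum>p\<in>?P. \<bar>K\<bar> ^ CARD('n)) + 1"
    if X: "\<forall>i j. \<bar>X $ i $ j\<bar> \<le> K" for X :: "real ^ 'n ^ 'n"
  proof -
    have "\<bar>det X\<bar> \<le> (\<Sum>p\<in>?P. \<bar>of_int (sign p) * (\<Prod>i\<in>UNIV. X $ i $ p i)\<bar>)"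
      unfolding det_def by (rule sum_abs)
    also have "\<dots> \<le> (\<Sum>p\<in>?P. \<bar>K\<bar> ^ CARD('n))"
    proof (rule sum_mono)
      fix p
      have "\<bar>of_int (sign p) * (\<Prod>i\<in>UNIV. X $ i $ p i)\<bar> = (\<Prod>i\<in>UNIV. \<bar>X $ i $ p i\<bar>)"
        by (simp add: abs_mult abs_prod sign_def)
      also have "\<dots> \<le> (\<Prod>i\<in>(UNIV :: 'n set). \<bar>K\<bar>)"
        using X by (intro prod_mono) (auto intro: order_trans[OF _ abs_ge_self])
      finally show "\<bar>of_int (sign p) * (\<Prod>i\<in>UNIV. X $ i $ p i)\<bar> \<le> \<bar>K\<bar> ^ CARD('n)"
        by simp
    qed
    finally show ?thesis by simp
  qed
  moreover have "(\<Sum>p\<in>?P. \<bar>K\<bar> ^ CARD('n)) + 1 > 0"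
    by (intro add_nonneg_pos sum_nonneg) auto
  ultimately show ?thesis by blast
qed

lemma abs_entry_le_norm: "\<bar>Y $ p $ i\<bar> \<le> norm Y" for Y :: "real ^ 'm ^ 'n"
  using component_le_norm_cart[of "Y $ p" i] Finite_Cartesian_Product.norm_nth_le[of Y p] by linarith

text \<open>The minors factor, which turns a bound on the entries of the rescaled frame into a bound
  on products of \<open>n\<close> of the scaling factors.\<close>

lemma det_selected_columns:
  fixes A :: "real ^ 'n ^ 'm" and f :: "'n \<Rightarrow> 'm"
  shows "det (\<chi> k p. scaled_frame A C s $ p $ f k) =
    (\<Prod>k\<in>UNIV. s $ f k) * (det (\<chi> k. A $ f k) * det C)"
proof -
  have "(\<chi> k p. scaled_frame A C s $ p $ f k) =
      (\<chi> k. s $ f k *s ((\<chi> k. A $ f k) ** transpose C) $ k)"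
    by (simp add: vec_eq_iff scaled_frame_def matrix_matrix_mult_def inner_vec_def transpose_def mult.commute)
  then show ?thesis by (simp add: det_rows_mul det_mul)
qed

text \<open>Bounded entries bound the minors, hence all products of \<open>n\<close> scaling factors, hence the
  factors from above and, their full product being 1, from below.  The vectors \<open>C a\<^sub>i\<close> are then
  bounded, and \<open>n\<close> independent \<open>a\<^sub>i\<close> determine \<open>C\<close>.\<close>

lemma unimodular_sublevel_bounded:
  fixes A :: "real ^ 'n ^ 'm"
  assumes less: "CARD('n) < CARD('m)" and gp: "general_position A"
  shows "\<exists>R. \<forall>C s. unimodular C s \<longrightarrow> norm (scaled_frame A C s) \<le> K \<longrightarrow> norm C \<le> R \<and> norm s \<le> R"
proof -
  obtain M where M: "M > 0"
    and detM: "\<And>X :: real ^ 'n ^ 'n. (\<And>i j. \<bar>X $ i $ j\<bar> \<le> K) \<Longrightarrow> \<bar>det X\<bar> \<le> M"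
    using det_bounded_by_entries[of K] by blast
  \<comment> \<open>A bound for the product of any \<open>n\<close> scaling factors; summing over all maps \<open>f\<close>
    replaces a maximum over the injective ones.\<close>
  define L where "L = 1 + (\<Sum>f\<in>(UNIV :: ('n \<Rightarrow> 'm) set). M / \<bar>det (\<chi> k. A $ f k)\<bar>)"
  define R where "R = L ^ CARD('n)"
  have "L \<ge> 1" unfolding L_def using M by (simp add: sum_nonneg)
  then have R1: "R \<ge> 1" by (simp add: R_def)
  obtain f :: "'n \<Rightarrow> 'm" where f: "inj f"
    using card_le_inj[of "UNIV :: 'n set" "UNIV :: 'm set"] less by auto
  obtain G where G: "G ** (\<chi> k. A $ f k) = mat 1"
    using general_position_invertible[OF gp f] invertible_left_inverse by blast
  define R2 where "R2 = (\<Sum>p\<in>(UNIV :: 'n set). \<Sum>j\<in>(UNIV :: 'n set).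
      \<Sum>k\<in>(UNIV :: 'n set). \<bar>G $ j $ k\<bar> * (K * R ^ CARD('m)))"
  have bound: "norm C \<le> R2 \<and> norm s \<le> real CARD('m) * R"
    if us: "unimodular C s" and le: "norm (scaled_frame A C s) \<le> K" for C s
  proof -
    have detC: "det C = 1" and pos: "\<And>i. s $ i > 0" and prod: "(\<Prod>i\<in>UNIV. s $ i) = 1"
      using us by (auto simp: unimodular_def)
    have entry: "\<bar>scaled_frame A C s $ p $ i\<bar> \<le> K" for p i
      using abs_entry_le_norm le by (rule order_trans)
    have subset_prod: "(\<Prod>i\<in>S. s $ i) \<le> L" if "card S = CARD('n)" for S
    proof -
      obtain h :: "'n \<Rightarrow> 'm" where h: "bij_betw h UNIV S"
        using finite_same_card_bij[of "UNIV :: 'n set" S] \<open>card S = CARD('n)\<close> by auto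
      then have inj: "inj h" by (simp add: bij_betw_def)
      let ?d = "det (\<chi> k. A $ h k)"
      have d: "?d \<noteq> 0" using general_position_invertible[OF gp inj] by (simp add: invertible_det_nz)
      have "(\<Prod>i\<in>S. s $ i) = (\<Prod>k\<in>UNIV. s $ h k)" by (rule prod.reindex_bij_betw[OF h, symmetric])
      moreover have "\<bar>(\<Prod>k\<in>UNIV. s $ h k) * (?d * det C)\<bar> \<le> M"
        unfolding det_selected_columns[symmetric] by (rule detM) (simp add: entry)
      ultimately have "(\<Prod>i\<in>S. s $ i) * \<bar>?d\<bar> \<le> M"
        using pos by (simp add: detC abs_mult abs_prod abs_of_pos)
      then have "(\<Prod>i\<in>S. s $ i) \<le> M / \<bar>?d\<bar>" using d by (simp add: field_simps)
      also have "\<dots> \<le> (\<Sum>f\<in>(UNIV :: ('n \<Rightarrow> 'm) set). M / \<bar>det (\<chi> k. A $ f k)\<bar>)"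
        using M by (intro member_le_sum) auto
      finally show ?thesis by (simp add: L_def)
    qed
    \<comment> \<open>The strict inequality \<open>n < N\<close> matters here: for \<open>n = N\<close> the only subset product is
      the full one.\<close>
    have sR: "s $ i \<le> R" for i
      unfolding R_def using bounded_if_subset_products_bounded[of "CARD('n)" "\<lambda>i. s $ i" L i]
        less pos prod \<open>L \<ge> 1\<close> subset_prod by simp
    have s_lower: "1 \<le> s $ i * R ^ CARD('m)" for i
    proof -
      have "1 = s $ i * (\<Prod>j\<in>UNIV - {i}. s $ j)" using prod by (simp add: prod.remove)
      also have "\<dots> \<le> s $ i * (\<Prod>j\<in>UNIV - {i}. R)"
        using pos[of i] by (intro mult_left_mono prod_mono) (auto simp: sR intro: less_imp_le pos)
      also have "\<dots> \<le> s $ i * R ^ CARD('m)"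
        using pos[of i] R1 by (intro mult_left_mono) (auto intro!: power_increasing)
      finally show ?thesis .
    qed
    have CA: "\<bar>C $ p \<bullet> A $ i\<bar> \<le> K * R ^ CARD('m)" for p i
    proof -
      have "\<bar>C $ p \<bullet> A $ i\<bar> * 1 \<le> \<bar>C $ p \<bullet> A $ i\<bar> * (s $ i * R ^ CARD('m))"
        by (intro mult_left_mono s_lower) auto
      also have "\<dots> = \<bar>scaled_frame A C s $ p $ i\<bar> * R ^ CARD('m)"
        using pos[of i] by (simp add: scaled_frame_def abs_mult)
      also have "\<dots> \<le> K * R ^ CARD('m)"
        using R1 by (intro mult_right_mono entry) auto
      finally show ?thesis by simp
    qed
    have C_entry: "\<bar>C $ p $ j\<bar> \<le> (\<Sum>k\<in>UNIV. \<bar>G $ j $ k\<bar> * (K * R ^ CARD('m)))" for p j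
    proof -
      have "C $ p $ j = (G *v ((\<chi> k. A $ f k) *v C $ p)) $ j" by (simp add: matrix_vector_mul_assoc G)
      also have "\<dots> = (\<Sum>k\<in>UNIV. G $ j $ k * (C $ p \<bullet> A $ f k))"
        unfolding matrix_vector_mult_def[of G]
        by (simp add: matrix_vector_mul_component inner_commute[of "C $ p"])
      finally have "\<bar>C $ p $ j\<bar> = \<bar>\<Sum>k\<in>UNIV. G $ j $ k * (C $ p \<bullet> A $ f k)\<bar>"
        by (rule arg_cong)
      also have "\<dots> \<le> (\<Sum>k\<in>UNIV. \<bar>G $ j $ k * (C $ p \<bullet> A $ f k)\<bar>)" by (rule sum_abs)
      also have "\<dots> \<le> (\<Sum>k\<in>UNIV. \<bar>G $ j $ k\<bar> * (K * R ^ CARD('m)))"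
        by (intro sum_mono) (simp add: abs_mult mult_left_mono CA)
      finally show ?thesis .
    qed
    have "norm C \<le> (\<Sum>p\<in>UNIV. norm (C $ p))"
      unfolding norm_vec_def[of C] by (rule L2_set_le_sum) simp
    also have "\<dots> \<le> (\<Sum>p\<in>UNIV. \<Sum>j\<in>UNIV. \<bar>C $ p $ j\<bar>)"
      by (intro sum_mono norm_le_l1_cart)
    also have "\<dots> \<le> R2"
      unfolding R2_def by (intro sum_mono C_entry)
    finally have "norm C \<le> R2" .
    moreover have "norm s \<le> (\<Sum>i\<in>(UNIV :: 'm set). R)"
    proof (rule order_trans[OF norm_le_l1_cart sum_mono])
      show "\<bar>s $ i\<bar> \<le> R" for i using sR[of i] pos[of i] by simp
    qed
    ultimately show ?thesis by simp
  qed
  show ?thesis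
    using bound by (intro exI[of _ "max R2 (real CARD('m) * R)"]) (auto simp: le_max_iff_disj)
qed

lemma ex_minimal_scaled_frame:
  fixes A :: "real ^ 'n ^ 'm"
  assumes less: "CARD('n) < CARD('m)" and gp: "general_position A"
  obtains C :: "real ^ 'n ^ 'n" and s :: "real ^ 'm" where "unimodular C s"
    and "\<And>C' s'. unimodular C' s' \<Longrightarrow> norm (scaled_frame A C s) \<le> norm (scaled_frame A C' s')"
proof -
  let ?J = "\<lambda>(C, s). norm (scaled_frame A C s)"
  define K where "K = norm (scaled_frame A (mat 1) 1)"
  \<comment> \<open>Nonstrict signs keep the set closed; the product condition makes them strict.\<close>
  define Z where "Z = {(C :: real^'n^'n, s :: real^'m).
    det C = 1 \<and> (\<forall>i. 0 \<le> s $ i) \<and> (\<Prod>i\<in>UNIV. s $ i) = 1 \<and> norm (scaled_frame A C s) \<le> K}"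
  have Z_iff: "(C, s) \<in> Z \<longleftrightarrow> unimodular C s \<and> norm (scaled_frame A C s) \<le> K" for C s
  proof -
    have "0 < s $ i" if "\<forall>i. 0 \<le> s $ i" "(\<Prod>i\<in>UNIV. s $ i) = 1" for i
      using that by (metis UNIV_I finite order_le_less prod_zero zero_neq_one)
    then show ?thesis unfolding Z_def unimodular_def by (auto intro: less_imp_le)
  qed
  have contJ: "continuous_on UNIV ?J"
    unfolding scaled_frame_def case_prod_unfold by (intro continuous_intros)
  have "closed Z"
  proof -
    have "Z = {x. det (fst x) = 1} \<inter> (\<Inter>i. {x. 0 \<le> snd x $ i})
      \<inter> {x. (\<Prod>i\<in>UNIV. snd x $ i) = 1} \<inter> {x. ?J x \<le> K}"
      unfolding Z_def by auto
    moreover have "closed \<dots>"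
      unfolding det_def
      by (intro closed_Int closed_INT ballI closed_Collect_eq closed_Collect_le continuous_intros contJ)
    ultimately show ?thesis by simp
  qed
  moreover have "bounded Z"
  proof -
    obtain R where "\<forall>C s. unimodular C s \<longrightarrow> norm (scaled_frame A C s) \<le> K \<longrightarrow> norm C \<le> R \<and> norm s \<le> R"
      using unimodular_sublevel_bounded[OF less gp] by blast
    then have "Z \<subseteq> cball 0 R \<times> cball 0 R" by (auto simp: Z_iff)
    then show ?thesis using bounded_Times bounded_cball bounded_subset by blast
  qed
  ultimately have "compact Z" by (simp add: compact_eq_bounded_closed)
  moreover have in_Z: "(mat 1, 1) \<in> Z" by (simp add: Z_def K_def)
  ultimately obtain x where x: "x \<in> Z" "\<And>y. y \<in> Z \<Longrightarrow> ?J x \<le> ?J y"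
    using continuous_attains_inf[of Z ?J] continuous_on_subset[OF contJ] by blast
  obtain C s where Cs: "x = (C, s)" by (cases x)
  show ?thesis
  proof (rule that)
    show "unimodular C s" using x(1) by (simp add: Cs Z_iff)
    fix C' :: "real ^ 'n ^ 'n" and s' :: "real ^ 'm" assume us: "unimodular C' s'"
    show "norm (scaled_frame A C s) \<le> norm (scaled_frame A C' s')"
    proof (cases "norm (scaled_frame A C' s') \<le> K")
      case True
      then show ?thesis using x(2)[of "(C', s')"] us by (simp add: Cs Z_iff)
    next
      case False
      then show ?thesis using x(2)[OF in_Z] by (simp add: Cs K_def)
    qed
  qed
qed

section \<open>First-order conditions at a minimum\<close>

text \<open>If \<open>w a > w b\<close>, multiplying the first by \<open>u\<close> and dividing the second by \<open>u\<close>, for a suitable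
  \<open>u < 1\<close>, decreases the sum.  The scaling factors appear squared because \<open>w\<close> will consist of
  squared lengths.\<close>

lemma minimal_under_scalings_imp_equal:
  fixes w :: "'k::finite \<Rightarrow> real"
  assumes nonneg: "\<And>k. w k \<ge> 0"
    and min: "\<And>d. (\<And>k. d k > 0) \<Longrightarrow> (\<Prod>k\<in>UNIV. d k) = 1 \<Longrightarrow> (\<Sum>k\<in>UNIV. w k) \<le> (\<Sum>k\<in>UNIV. (d k)\<^sup>2 * w k)"
  shows "w a = w b"
proof -
  have le: "w a \<le> w b" for a b
  proof (rule ccontr)
    assume "\<not> w a \<le> w b"
    then have lt: "w b < w a" and ab: "a \<noteq> b" by auto
    \<comment> \<open>This choice puts \<open>u * w a\<close> at the midpoint of \<open>w a\<close> and \<open>w b\<close>.\<close>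
    define u where "u = (w a + w b) / (2 * w a)"
    have wa: "w a > 0" using lt nonneg[of b] by simp
    have u: "0 < u" "u < 1" "w b < u * w a"
      using lt wa nonneg[of b] by (auto simp: u_def field_simps)
    define d where "d k = (if k = a then sqrt u else if k = b then 1 / sqrt u else 1)" for k
    have prod: "(\<Prod>k\<in>UNIV. d k) = 1"
    proof -
      have "(\<Prod>k\<in>UNIV. d k) = (\<Prod>k\<in>{a, b}. d k)"
        by (rule prod.mono_neutral_right) (auto simp: d_def)
      then show ?thesis using ab u by (simp add: d_def)
    qed
    have "(\<Sum>k\<in>UNIV. ((d k)\<^sup>2 - 1) * w k) = (\<Sum>k\<in>{a, b}. ((d k)\<^sup>2 - 1) * w k)"
      by (rule sum.mono_neutral_right) (auto simp: d_def)
    also have "\<dots> = (u - 1) * w a + (1 / u - 1) * w b"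
      using ab u by (simp add: d_def power_divide)
    also have "\<dots> = (1 - u) * (w b - u * w a) / u"
      using u by (simp add: field_simps)
    also have "\<dots> < 0"
      using u by (intro divide_neg_pos mult_pos_neg) auto
    finally have "(\<Sum>k\<in>UNIV. (d k)\<^sup>2 * w k) < (\<Sum>k\<in>UNIV. w k)"
      by (simp add: left_diff_distrib sum_subtractf)
    with min[OF _ prod] u show False by (simp add: d_def leD)
  qed
  show ?thesis using le[of a b] le[of b a] by simp
qed

lemma minimal_under_shears_imp_orthogonal:
  fixes y z :: "'a::real_inner"
  assumes "\<And>t. norm y \<le> norm (y + t *\<^sub>R z)"
  shows "y \<bullet> z = 0"
proof (cases "z = 0")
  case False
  \<comment> \<open>The minimiser of the quadratic in \<open>t\<close>.\<close>
  define t where "t = - (y \<bullet> z) / (z \<bullet> z)"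
  have "y \<bullet> y \<le> (y + t *\<^sub>R z) \<bullet> (y + t *\<^sub>R z)"
    using assms[of t] by (simp add: norm_le)
  also have "\<dots> = y \<bullet> y - (y \<bullet> z)\<^sup>2 / (z \<bullet> z)"
    using False by (simp add: t_def inner_simps inner_commute[of z y] field_simps power2_eq_square)
  finally have "(y \<bullet> z)\<^sup>2 / (z \<bullet> z) \<le> 0" by simp
  moreover have "z \<bullet> z > 0" using False by simp
  ultimately have "(y \<bullet> z)\<^sup>2 \<le> 0" by (simp add: divide_le_0_iff)
  then show ?thesis by simp
qed simp

lemma norm_sq_rows: "(norm Y)\<^sup>2 = (\<Sum>p\<in>UNIV. (norm (Y $ p))\<^sup>2)" for Y :: "real ^ 'm ^ 'n"
  by (simp add: norm_vec_def[of Y] L2_set_def sum_nonneg)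

lemma norm_sq_columns: "(norm Y)\<^sup>2 = (\<Sum>i\<in>UNIV. \<Sum>p\<in>UNIV. (Y $ p $ i)\<^sup>2)" for Y :: "real ^ 'm ^ 'n"
  by (subst sum.swap) (simp add: norm_sq_rows norm_vec_def[of "Y $ _"] L2_set_def sum_nonneg)

text \<open>Each conclusion compares the minimum with a one-parameter family of competitors that stays
  inside the constraint set: shears of \<open>C\<close>, reciprocal scalings of two rows of \<open>C\<close>, and
  reciprocal scalings of two entries of \<open>s\<close>.  These act on the rescaled frame by the same
  operations on its rows and columns.\<close>

lemma minimal_scaled_frame_balanced:
  fixes A :: "real ^ 'n ^ 'm"
  assumes us: "unimodular C s"
    and min: "\<And>C' s'. unimodular C' s' \<Longrightarrow> norm (scaled_frame A C s) \<le> norm (scaled_frame A C' s')"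
  defines "Y \<equiv> scaled_frame A C s"
  shows "p \<noteq> q \<Longrightarrow> Y $ p \<bullet> Y $ q = 0"
    and "(norm (Y $ p))\<^sup>2 = (norm (Y $ q))\<^sup>2"
    and "(\<Sum>p\<in>UNIV. (Y $ p $ i)\<^sup>2) = (\<Sum>p\<in>UNIV. (Y $ p $ j)\<^sup>2)"
proof -
  have detC: "det C = 1" and pos: "\<And>i. s $ i > 0" and prod: "(\<Prod>i\<in>UNIV. s $ i) = 1"
    using us by (auto simp: unimodular_def)
  have min2: "(norm Y)\<^sup>2 \<le> (norm (scaled_frame A C' s'))\<^sup>2" if "unimodular C' s'" for C' s'
    using min[OF that] by (simp add: Y_def power_mono)
  show "Y $ p \<bullet> Y $ q = 0" if pq: "p \<noteq> q"
  proof (rule minimal_under_shears_imp_orthogonal)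
    fix t
    define C' where "C' = (\<chi> k. if k = p then row p C + t *s row q C else row k C)"
    have "det C' = 1" unfolding C'_def by (simp add: det_row_operation[OF pq] detC)
    then have "(norm Y)\<^sup>2 \<le> (norm (scaled_frame A C' s))\<^sup>2"
      using us by (intro min2) (simp add: unimodular_def)
    moreover have "scaled_frame A C' s $ k = (if k = p then Y $ p + t *\<^sub>R Y $ q else Y $ k)" for k
      by (simp add: Y_def C'_def scaled_frame_def vec_eq_iff row_def inner_simps scalar_mult_eq_scaleR algebra_simps)
    ultimately have "(\<Sum>k\<in>UNIV. (norm (Y $ k))\<^sup>2)
        \<le> (\<Sum>k\<in>UNIV. (norm (if k = p then Y $ p + t *\<^sub>R Y $ q else Y $ k))\<^sup>2)"
      by (simp add: norm_sq_rows)
    then have "(norm (Y $ p))\<^sup>2 \<le> (norm (Y $ p + t *\<^sub>R Y $ q))\<^sup>2"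
      by (simp add: sum.remove[of UNIV p])
    then show "norm (Y $ p) \<le> norm (Y $ p + t *\<^sub>R Y $ q)" by simp
  qed
  show "(norm (Y $ p))\<^sup>2 = (norm (Y $ q))\<^sup>2"
  proof (rule minimal_under_scalings_imp_equal[where w = "\<lambda>k. (norm (Y $ k))\<^sup>2"])
    fix d :: "'n \<Rightarrow> real" assume d: "\<And>k. d k > 0" "(\<Prod>k\<in>UNIV. d k) = 1"
    have "det (\<chi> k. d k *s C $ k) = 1" by (simp add: det_rows_mul d(2) detC)
    then have "(norm Y)\<^sup>2 \<le> (norm (scaled_frame A (\<chi> k. d k *s C $ k) s))\<^sup>2"
      using us by (intro min2) (simp add: unimodular_def)
    moreover have "scaled_frame A (\<chi> k. d k *s C $ k) s $ k = d k *\<^sub>R Y $ k" for k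
      by (simp add: Y_def scaled_frame_def vec_eq_iff scalar_mult_eq_scaleR)
    ultimately show "(\<Sum>k\<in>UNIV. (norm (Y $ k))\<^sup>2) \<le> (\<Sum>k\<in>UNIV. (d k)\<^sup>2 * (norm (Y $ k))\<^sup>2)"
      by (simp add: norm_sq_rows power_mult_distrib)
  qed simp
  show "(\<Sum>p\<in>UNIV. (Y $ p $ i)\<^sup>2) = (\<Sum>p\<in>UNIV. (Y $ p $ j)\<^sup>2)"
  proof (rule minimal_under_scalings_imp_equal[where w = "\<lambda>i. \<Sum>p\<in>UNIV. (Y $ p $ i)\<^sup>2"])
    fix d :: "'m \<Rightarrow> real" assume d: "\<And>k. d k > 0" "(\<Prod>k\<in>UNIV. d k) = 1"
    have "unimodular C (\<chi> i. d i * s $ i)"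
      using us d by (simp add: unimodular_def prod.distrib)
    from min2[OF this] show "(\<Sum>k\<in>UNIV. \<Sum>p\<in>UNIV. (Y $ p $ k)\<^sup>2)
        \<le> (\<Sum>k\<in>UNIV. (d k)\<^sup>2 * (\<Sum>p\<in>UNIV. (Y $ p $ k)\<^sup>2))"
      by (simp add: norm_sq_columns Y_def scaled_frame_def power_mult_distrib sum_distrib_left mult.assoc)
  qed (simp add: sum_nonneg)
qed

section \<open>Balancing matrices\<close>

lemma diag_inv_sqrt_mult_row:
  "(diag_inv_sqrt D ** A) $ i = (1 / sqrt (D $ i $ i)) *\<^sub>R A $ i"
  by (simp add: vec_eq_iff diag_inv_sqrt_def matrix_matrix_mult_def if_distrib[of "\<lambda>x. x * _"] cong: if_cong)

definition balances :: "real ^ 'n ^ 'm \<Rightarrow> real ^ 'm ^ 'm \<Rightarrow> bool" where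
  "balances A D \<longleftrightarrow>
     (\<exists>(B :: real ^ 'n ^ 'n) (Q :: real ^ 'n ^ 'm).
        invertible B \<and>
        transpose Q ** Q = mat 1 \<and>
        (\<forall>i. (Q ** transpose Q) $ i $ i = real CARD('n) / real CARD('m)) \<and>
        diag_inv_sqrt D ** A = Q ** B)"

lemma diag_mult_transpose: "(Q ** transpose Q) $ i $ i = Q $ i \<bullet> Q $ i"
  by (simp add: matrix_matrix_mult_def transpose_def inner_vec_def)

text \<open>Let \<open>Y\<close> be a minimal rescaled frame, with \<open>Y Y\<^sup>T = g I\<close> and columns of squared
  length \<open>h\<close>.  Computing the squared norm of \<open>Y\<close> by rows and by columns gives \<open>n g = N h\<close>, so the
  rows of \<open>Q = Y\<^sup>T / g\<^bsup>1/2\<^esup>\<close> have squared length \<open>h / g = n / N\<close>.  The factor \<open>\<kappa>\<close> below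
  only serves the normalisation of \<open>D\<close>, and \<open>B\<close> is a multiple of the inverse of \<open>C\<^sup>T\<close>.\<close>

lemma exists_balancing:
  fixes A :: "real ^ 'n ^ 'm"
  assumes less: "CARD('n) < CARD('m)" and gp: "general_position A"
  shows "\<exists>D. is_diagonal D \<and> (\<forall>i. D $ i $ i > 0) \<and>
    (norm (diag_inv_sqrt D ** A))\<^sup>2 = real CARD('m) \<and> balances A D"
proof -
  obtain C s where us: "unimodular C s"
    and min: "\<And>C' s'. unimodular C' s' \<Longrightarrow> norm (scaled_frame A C s) \<le> norm (scaled_frame A C' s')"
    using ex_minimal_scaled_frame[OF less gp] by blast
  define Y where "Y = scaled_frame A C s"
  note balanced = minimal_scaled_frame_balanced[OF us min, folded Y_def]
  have pos: "\<And>i. s $ i > 0" using us by (simp add: unimodular_def)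
  have "det (transpose C) \<noteq> 0" using us by (simp add: unimodular_def)
  then obtain G where G: "transpose C ** G = mat 1"
    using invertible_det_nz invertible_right_inverse by blast
  then have "invertible G" using invertible_left_inverse by blast
  fix p0 :: 'n and i0 :: 'm
  define g where "g = (norm (Y $ p0))\<^sup>2"
  have YY: "Y $ p \<bullet> Y $ q = (if p = q then g else 0)" for p q
    using balanced(1,2) by (auto simp: g_def power2_norm_eq_inner)
  define h where "h = (\<Sum>p\<in>UNIV. (Y $ p $ i0)\<^sup>2)"
  have colY: "(\<Sum>p\<in>UNIV. (Y $ p $ i)\<^sup>2) = h" for i
    using balanced(3)[of i i0] by (simp add: h_def)
  have gh: "real CARD('n) * g = real CARD('m) * h"
    using norm_sq_rows[of Y] unfolding norm_sq_columns colY power2_norm_eq_inner YY by simp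
  obtain f :: "'n \<Rightarrow> 'm" where f: "inj f"
    using card_le_inj[of "UNIV :: 'n set" "UNIV :: 'm set"] less by auto
  have nz: "z = 0" if "\<And>i. A $ i \<bullet> z = 0" for z
    using gp f that by (auto simp: general_position_def)
  have "g \<noteq> 0"
  proof
    assume "g = 0"
    then have "Y $ p0 = 0" by (simp add: g_def)
    then have "A $ i \<bullet> C $ p0 = 0" for i
      using pos[of i] by (simp add: Y_def scaled_frame_def vec_eq_iff inner_commute) (metis less_irrefl)
    then have "row p0 C = 0" by (simp add: nz row_def)
    then have "det C = 0" by (rule det_zero_row)
    then show False using us by (simp add: unimodular_def)
  qed
  then have g: "g > 0" by (simp add: g_def)
  define \<sigma> where "\<sigma> = (\<Sum>i\<in>UNIV. (s $ i)\<^sup>2 * (norm (A $ i))\<^sup>2)"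
  have "\<sigma> > 0"
  proof -
    have "\<sigma> \<noteq> 0"
    proof
      assume "\<sigma> = 0"
      then have "\<forall>i. (s $ i)\<^sup>2 * (norm (A $ i))\<^sup>2 = 0"
        unfolding \<sigma>_def by (subst (asm) sum_nonneg_eq_0_iff) auto
      then have "A $ i = 0" for i using pos[of i] by (metis mult_eq_0_iff less_irrefl norm_eq_zero power_eq_0_iff)
      then show False using nz[of "axis p0 1"] by (simp add: axis_eq_0_iff)
    qed
    moreover have "\<sigma> \<ge> 0" unfolding \<sigma>_def by (intro sum_nonneg) auto
    ultimately show ?thesis by simp
  qed
  define \<kappa> where "\<kappa> = real CARD('m) / \<sigma>"
  have \<kappa>: "\<kappa> > 0" using \<open>\<sigma> > 0\<close> by (simp add: \<kappa>_def)
  define D :: "real ^ 'm ^ 'm" where "D = (\<chi> i j. if i = j then 1 / (\<kappa> * (s $ i)\<^sup>2) else 0)"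
  have row: "(diag_inv_sqrt D ** A) $ i = (sqrt \<kappa> * s $ i) *\<^sub>R A $ i" for i
    using pos[of i] \<kappa> by (simp add: diag_inv_sqrt_mult_row D_def real_sqrt_divide real_sqrt_mult)
  define Q where "Q = (\<chi> i p. Y $ p $ i / sqrt g)"
  define B where "B = sqrt (\<kappa> * g) *\<^sub>R G"
  have "transpose Q ** Q = mat 1"
  proof -
    have "(\<Sum>i\<in>UNIV. Y $ p $ i * Y $ q $ i) / g = (if p = q then 1 else 0)" for p q
      using YY[of p q] g by (simp add: inner_vec_def)
    then show ?thesis
      using g by (simp add: vec_eq_iff Q_def matrix_matrix_mult_def transpose_def mat_def flip: sum_divide_distrib)
  qed
  moreover have "(Q ** transpose Q) $ i $ i = real CARD('n) / real CARD('m)" for i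
  proof -
    have "(Q ** transpose Q) $ i $ i = h / g"
      using g by (simp add: diag_mult_transpose Q_def inner_vec_def colY power2_eq_square
          flip: sum_divide_distrib colY[of i])
    also have "\<dots> = real CARD('n) / real CARD('m)"
      using gh g by (simp add: field_simps)
    finally show ?thesis .
  qed
  moreover have "invertible B"
    using \<open>invertible G\<close> \<kappa> g by (simp add: B_def scalar_invertible)
  moreover have "diag_inv_sqrt D ** A = Q ** B"
  proof -
    have "Q $ i = (s $ i / sqrt g) *\<^sub>R (A ** transpose C) $ i" for i
      by (simp add: Q_def Y_def scaled_frame_def vec_eq_iff matrix_matrix_mult_def transpose_def inner_vec_def mult.commute)
    then have "(Q ** B) $ i = ((s $ i / sqrt g) * sqrt (\<kappa> * g)) *\<^sub>R ((A ** transpose C) ** G) $ i" for i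
      by (simp add: vec_eq_iff B_def matrix_matrix_mult_def[of _ G] matrix_matrix_mult_def[of Q]
          sum_distrib_left mult_ac)
    then have "(Q ** B) $ i = (sqrt \<kappa> * s $ i) *\<^sub>R A $ i" for i
      using g by (simp add: matrix_mul_assoc[symmetric] G real_sqrt_mult)
    then show ?thesis by (simp add: vec_eq_iff[of "_ ** A"] row)
  qed
  ultimately have "balances A D" unfolding balances_def by blast
  moreover have "(norm (diag_inv_sqrt D ** A))\<^sup>2 = real CARD('m)"
  proof -
    have "(norm (diag_inv_sqrt D ** A))\<^sup>2 = \<kappa> * \<sigma>"
      using \<kappa> by (simp add: norm_sq_rows row power_mult_distrib \<sigma>_def sum_distrib_left mult.assoc)
    then show ?thesis using \<open>\<sigma> > 0\<close> by (simp add: \<kappa>_def)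
  qed
  moreover have "is_diagonal D" "\<forall>i. D $ i $ i > 0"
    using \<kappa> less_imp_neq[OF pos, symmetric] by (auto simp: is_diagonal_def D_def intro!: mult_pos_pos)
  ultimately show ?thesis by blast
qed

section \<open>Uniqueness\<close>

lemma general_position_scaled_mult:
  fixes A Q :: "real ^ 'n ^ 'm" and B :: "real ^ 'n ^ 'n"
  assumes gp: "general_position A" and inv: "invertible B" and pos: "\<And>i. d i > 0"
    and rows: "\<And>i. (Q ** B) $ i = d i *\<^sub>R A $ i"
  shows "general_position Q"
  unfolding general_position_def
proof (intro allI impI)
  fix f :: "'n \<Rightarrow> 'm" and z :: "real ^ 'n"
  assume f: "inj f" and z: "\<forall>k. Q $ f k \<bullet> z = 0"
  obtain B' where B': "B ** B' = mat 1" using inv invertible_right_inverse by blast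
  have "d (f k) * (A $ f k \<bullet> (B' *v z)) = 0" for k
  proof -
    have "d (f k) * (A $ f k \<bullet> (B' *v z)) = ((Q ** B) *v (B' *v z)) $ f k"
      by (simp add: matrix_vector_mul_component rows)
    also have "\<dots> = Q $ f k \<bullet> z"
      by (simp add: matrix_vector_mul_assoc matrix_mul_assoc[symmetric] B' matrix_vector_mul_component)
    finally show ?thesis using z by simp
  qed
  then have "A $ f k \<bullet> (B' *v z) = 0" for k using pos[of "f k"] by (metis less_irrefl mult_eq_0_iff)
  then have "B' *v z = 0" using gp f by (auto simp: general_position_def)
  then have "B *v (B' *v z) = 0" by simp
  then show "z = 0" by (simp add: matrix_vector_mul_assoc B')
qed

text \<open>Two factorisations \<open>Q B\<close> and \<open>Q' B'\<close> of rescalings of the same matrix satisfy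
  \<open>Q' (B' B\<^sup>-\<^sup>1) = diag(\<rho>) Q\<close>, so that the rigidity of tight frames applies with
  \<open>F = B' B\<^sup>-\<^sup>1\<close>.\<close>

lemma balancing_unique_up_to_scale:
  fixes A :: "real ^ 'n ^ 'm"
  assumes less: "CARD('n) < CARD('m)" and gp: "general_position A"
    and D: "\<And>i. D $ i $ i > 0" "balances A D" and D': "\<And>i. D' $ i $ i > 0" "balances A D'"
  shows "D $ i $ i / D' $ i $ i = D $ j $ j / D' $ j $ j"
proof -
  obtain B :: "real ^ 'n ^ 'n" and Q :: "real ^ 'n ^ 'm" where B: "invertible B" and orth: "transpose Q ** Q = mat 1"
    and diag: "\<And>i. (Q ** transpose Q) $ i $ i = real CARD('n) / real CARD('m)"
    and eq: "diag_inv_sqrt D ** A = Q ** B"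
    using D(2) unfolding balances_def by blast
  obtain B' :: "real ^ 'n ^ 'n" and Q' :: "real ^ 'n ^ 'm" where B': "invertible B'" and orth': "transpose Q' ** Q' = mat 1"
    and diag': "\<And>i. (Q' ** transpose Q') $ i $ i = real CARD('n) / real CARD('m)"
    and eq': "diag_inv_sqrt D' ** A = Q' ** B'"
    using D'(2) unfolding balances_def by blast
  obtain G where G: "B ** G = mat 1" using B invertible_right_inverse by blast
  define \<rho> where "\<rho> i = sqrt (D $ i $ i) / sqrt (D' $ i $ i)" for i
  have gpQ: "general_position Q"
    using general_position_scaled_mult[OF gp B, of "\<lambda>i. 1 / sqrt (D $ i $ i)" Q] D(1)
    by (simp add: diag_inv_sqrt_mult_row flip: eq)
  have rel: "Q' $ i \<bullet> ((B' ** G) *v v) = \<rho> i * (Q $ i \<bullet> v)" for i v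
  proof -
    have "Q' $ i \<bullet> ((B' ** G) *v v) = ((Q' ** B') *v (G *v v)) $ i"
      by (simp add: matrix_vector_mul_component[symmetric] matrix_vector_mul_assoc matrix_mul_assoc)
    also have "\<dots> = \<rho> i * ((Q ** B) *v (G *v v)) $ i"
      using D(1)[of i] D'(1)[of i]
      by (simp add: matrix_vector_mul_component diag_inv_sqrt_mult_row \<rho>_def flip: eq eq')
    also have "((Q ** B) *v (G *v v)) $ i = Q $ i \<bullet> v"
      by (simp add: matrix_vector_mul_assoc matrix_mul_assoc[symmetric] G matrix_vector_mul_component)
    finally show ?thesis .
  qed
  have "\<rho> i = \<rho> j"
    by (rule tight_frame_scaling_constant[OF less gpQ orth orth' _ _ _ rel])
      (use diag diag' D(1) D'(1) in \<open>auto simp: diag_mult_transpose \<rho>_def\<close>)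
  then show ?thesis by (simp add: \<rho>_def flip: real_sqrt_divide)
qed

lemma balancing_unique:
  fixes A :: "real ^ 'n ^ 'm"
  assumes less: "CARD('n) < CARD('m)" and gp: "general_position A"
    and D: "is_diagonal D" "\<And>i. D $ i $ i > 0" "balances A D"
    and D': "is_diagonal D'" "\<And>i. D' $ i $ i > 0" "balances A D'"
    and normalized: "norm (diag_inv_sqrt D ** A) = norm (diag_inv_sqrt D' ** A)"
      "norm (diag_inv_sqrt D ** A) \<noteq> 0"
  shows "D = D'"
proof -
  fix i0 :: 'm
  define c where "c = D $ i0 $ i0 / D' $ i0 $ i0"
  have c: "c > 0" using D(2) D'(2) by (simp add: c_def)
  have Dc: "D $ i $ i = c * D' $ i $ i" for i
    using balancing_unique_up_to_scale[OF less gp D(2,3) D'(2,3), of i i0] D'(2)[of i]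
    by (simp add: c_def field_simps)
  have "diag_inv_sqrt D ** A = (1 / sqrt c) *\<^sub>R (diag_inv_sqrt D' ** A)"
    by (simp add: vec_eq_iff[of "_ ** A"] diag_inv_sqrt_mult_row Dc real_sqrt_mult)
  then have "norm (diag_inv_sqrt D ** A) = norm (diag_inv_sqrt D' ** A) / sqrt c"
    using c by simp
  then have "sqrt c = 1" using normalized c by (simp add: field_simps)
  then have "D $ i $ j = D' $ i $ j" for i j
    using D(1) D'(1) Dc[of i] by (cases "i = j") (auto simp: is_diagonal_def)
  then show ?thesis by (simp add: vec_eq_iff)
qed

theorem theorem2p13:
  fixes A :: "real ^ 'n ^ 'm"
  assumes "CARD('n) < CARD('m)"
    and "rank_star A"
  shows "\<exists>!D :: real ^ 'm ^ 'm.
           is_diagonal D \<and>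
           (\<forall>i. D $ i $ i > 0) \<and>
           (frobenius_norm (diag_inv_sqrt D ** A))\<^sup>2 = real CARD('m) \<and>
           (\<exists>(B :: real ^ 'n ^ 'n) (Q :: real ^ 'n ^ 'm).
              invertible B \<and>
              transpose Q ** Q = mat 1 \<and>
              (\<forall>i. (Q ** transpose Q) $ i $ i = real CARD('n) / real CARD('m)) \<and>
              diag_inv_sqrt D ** A = Q ** B)"
proof -
  have gp: "general_position A" using assms(2) by (rule rank_star_imp_general_position)
  show ?thesis
    unfolding frobenius_norm_eq_norm balances_def[symmetric]
  proof (rule ex_ex1I)
    fix D D' :: "real ^ 'm ^ 'm"
    assume D: "is_diagonal D \<and> (\<forall>i. D $ i $ i > 0) \<and>
        (norm (diag_inv_sqrt D ** A))\<^sup>2 = real CARD('m) \<and> balances A D"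
      and D': "is_diagonal D' \<and> (\<forall>i. D' $ i $ i > 0) \<and>
        (norm (diag_inv_sqrt D' ** A))\<^sup>2 = real CARD('m) \<and> balances A D'"
    have "norm (diag_inv_sqrt D ** A) = norm (diag_inv_sqrt D' ** A)"
      by (rule power2_eq_imp_eq) (use D D' in auto)
    moreover have "norm (diag_inv_sqrt D ** A) \<noteq> 0"
    proof
      assume "norm (diag_inv_sqrt D ** A) = 0"
      with D show False by simp
    qed
    ultimately show "D = D'"
      using D D' by (intro balancing_unique[OF assms(1) gp]) auto
  qed (rule exists_balancing[OF assms(1) gp])
qed

end
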